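(* Let $G$ be a connected graph of even order $n\ge 4$. Then the following statements are equivalent: (i) $\rho(G)=\frac n2$; (ii) $\gamma_1^{\mathrm L}(G)=\rho(G)$; (iii) $G$ is a corona graph.
   Context: All graphs are finite, simple and undirected; $N(v)$ is the open and $N[v]=N(v)\cup\{v\}$ the closed neighborhood of $v$. A dominating set of $G$ is a set $D\subseteq V(G)$ such that every vertex not in $D$ has a neighbor in $D$. A $1$-limited dominating set is a dominating set $D$ with $|N(u)-D|\le 1$ for every $u\in D$; $\gamma_1^{\mathrm L}(G)$ is the minimum cardinality of a $1$-limited dominating set. A set $S\subseteq V(G)$ is a packing if $N[u]\cap N[v]=\emptyset$ for all distinct $u,v\in S$; $\rho(G)$ is the maximum cardinality of a packing. A corona graph is a graph $H\odot K_1$ obtained from a connected graph $H$ (here of order $\frac n2$) by attaching exactly one pendant vertex (new vertex of degree $1$) to each vertex of $H$. *)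

theory Defs
  imports "Graph_Theory.Graph_Theory"
begin

text \<open>
  A finite simple undirected graph is a \<open>pair_graph\<close>: a finite, loop-free \<open>pair_pre_digraph\<close>
  with a symmetric arc relation, each edge being represented by its two opposite arcs.
\<close>

definition open_nbhd :: "'a pair_pre_digraph \<Rightarrow> 'a \<Rightarrow> 'a set" where
  "open_nbhd G v = {w. v \<rightarrow>\<^bsub>G\<^esub> w}"

definition closed_nbhd :: "'a pair_pre_digraph \<Rightarrow> 'a \<Rightarrow> 'a set" where
  "closed_nbhd G v = insert v (open_nbhd G v)"

definition dominating_set :: "'a pair_pre_digraph \<Rightarrow> 'a set \<Rightarrow> bool" where
  "dominating_set G D \<longleftrightarrow>
     D \<subseteq> pverts G \<and> (\<forall>v \<in> pverts G - D. \<exists>u \<in> D. u \<in> open_nbhd G v)"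

definition limited1_dominating_set :: "'a pair_pre_digraph \<Rightarrow> 'a set \<Rightarrow> bool" where
  "limited1_dominating_set G D \<longleftrightarrow>
     dominating_set G D \<and> (\<forall>u \<in> D. card (open_nbhd G u - D) \<le> 1)"

definition limited1_domination_number :: "'a pair_pre_digraph \<Rightarrow> nat" where
  "limited1_domination_number G = Min {card D | D. limited1_dominating_set G D}"

definition packing :: "'a pair_pre_digraph \<Rightarrow> 'a set \<Rightarrow> bool" where
  "packing G S \<longleftrightarrow>
     S \<subseteq> pverts G \<and> (\<forall>u \<in> S. \<forall>v \<in> S. u \<noteq> v \<longrightarrow> closed_nbhd G u \<inter> closed_nbhd G v = {})"

definition packing_number :: "'a pair_pre_digraph \<Rightarrow> nat" where
  "packing_number G = Max {card S | S. packing G S}"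

text \<open>
  In \<open>H \<odot> K\<^sub>1\<close> the vertices of \<open>H\<close> are tagged by \<open>Inl\<close>, and \<open>Inr v\<close> is the pendant vertex
  attached to \<open>Inl v\<close>.
\<close>

definition corona_K1 :: "'a pair_pre_digraph \<Rightarrow> ('a + 'a) pair_pre_digraph" where
  "corona_K1 H =
     \<lparr>pverts = Inl ` pverts H \<union> Inr ` pverts H,
      parcs = {(Inl u, Inl v) | u v. (u, v) \<in> parcs H}
            \<union> {(Inl v, Inr v) | v. v \<in> pverts H}
            \<union> {(Inr v, Inl v) | v. v \<in> pverts H}\<rparr>"

text \<open>
  Letting \<open>H\<close> have the same vertex type as \<open>G\<close> is no restriction: \<open>H\<close> only matters up to
  isomorphism, and \<open>G\<close> contains a copy of it.
\<close>

definition corona_graph :: "'a pair_pre_digraph \<Rightarrow> bool" where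
  "corona_graph G \<longleftrightarrow>
     (\<exists>H :: 'a pair_pre_digraph. pair_graph H \<and> connected H \<and> digraph_iso (corona_K1 H) G)"

lemma pair_graph_corona_K1:
  assumes "pair_graph H"
  shows "pair_graph (corona_K1 H)"
proof -
  interpret pair_graph H by fact
  let ?G = "corona_K1 H"
  have sub: "parcs ?G \<subseteq> pverts ?G \<times> pverts ?G"
    by (auto simp: corona_K1_def dest: in_arcsD1 in_arcsD2)
  have fin: "finite (pverts ?G)"
    using pair_finite_verts by (simp add: corona_K1_def)
  have "finite (parcs ?G)"
    by (rule finite_subset[OF sub]) (simp add: fin)
  moreover have "symmetric ?G"
    unfolding symmetric_def sym_def by (auto simp: corona_K1_def dest: arcs_symmetric)
  moreover have "fst e \<noteq> snd e" if "e \<in> parcs ?G" for e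
    using that by (auto simp: corona_K1_def dest: no_loops')
  ultimately show ?thesis
    using sub fin by unfold_locales auto
qed

lemma limited1_dominating_set_pverts:
  assumes "pair_graph G"
  shows "limited1_dominating_set G (pverts G)"
proof -
  interpret pair_graph G by fact
  have "card (open_nbhd G u - pverts G) = 0" for u
    by (rule card_eq_0_iff[THEN iffD2]) (auto simp: open_nbhd_def dest: in_arcsD2)
  then show ?thesis
    by (simp add: limited1_dominating_set_def dominating_set_def)
qed

lemma limited1_domination_number_attained:
  assumes "pair_graph G"
  shows "\<exists>D. limited1_dominating_set G D \<and> card D = limited1_domination_number G"
proof -
  interpret pair_graph G by fact
  let ?A = "{card D | D. limited1_dominating_set G D}"
  have "?A \<subseteq> card ` Pow (pverts G)"
    by (auto simp: limited1_dominating_set_def dominating_set_def)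
  then have "finite ?A"
    using pair_finite_verts by (meson finite_Pow_iff finite_imageI finite_subset)
  moreover have "?A \<noteq> {}"
    using limited1_dominating_set_pverts[OF assms] by blast
  ultimately have "Min ?A \<in> ?A" by (rule Min_in)
  then show ?thesis by (auto simp: limited1_domination_number_def)
qed

lemma packing_number_attained:
  assumes "pair_graph G"
  shows "\<exists>S. packing G S \<and> card S = packing_number G"
proof -
  interpret pair_graph G by fact
  let ?A = "{card S | S. packing G S}"
  have "?A \<subseteq> card ` Pow (pverts G)"
    by (auto simp: packing_def)
  then have "finite ?A"
    using pair_finite_verts by (meson finite_Pow_iff finite_imageI finite_subset)
  moreover have "packing G {}" by (simp add: packing_def)
  then have "?A \<noteq> {}" by blast
  ultimately have "Max ?A \<in> ?A" by (rule Max_in)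
  then show ?thesis by (auto simp: packing_number_def)
qed

end

theory Submission
  imports Defs
begin

text \<open>
  In a connected graph of order \<open>n \<ge> 2\<close> the packing number \<open>\<rho>\<close> and the 1-limited domination
  number \<open>\<gamma>\<close> lie on opposite sides of half the order: \<open>2 \<rho> \<le> n \<le> 2 \<gamma>\<close>.
  The left inequality (\<open>card_packing_le\<close>) holds because no vertex is isolated, so that the disjoint
  closed neighborhoods of the vertices of a packing have at least two elements each; the right one
  (\<open>card_limited1_dominating_ge\<close>) because every vertex of a 1-limited dominating set accounts for
  at most one vertex outside of it. Hence \<open>\<gamma> = \<rho>\<close> forces \<open>\<rho> = n div 2\<close>.

  The leaves of a corona are both a packing and a 1-limited dominating set
  (\<open>corona_graph_packing_dominating\<close>), which gives \<open>\<gamma> \<le> \<rho>\<close> and so collapses the chain of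
  inequalities.

  Finally, suppose that a packing \<open>S\<close> has \<open>n div 2\<close> elements (\<open>half_packing_imp_corona_graph\<close>).
  Then there is no slack in the left inequality: the closed neighborhoods of the vertices of \<open>S\<close>
  have exactly two elements and partition the vertex set. So \<open>S\<close> consists of leaves, and
  assigning to each leaf its unique neighbor is a bijection from \<open>S\<close> onto the complement of \<open>S\<close>;
  that is, the graph is the corona of its subgraph induced by the complement of \<open>S\<close>. This subgraph is
  connected because moving every leaf to its neighbor turns a walk into a walk in which some vertices
  may be repeated consecutively (\<open>connected_image\<close>).
\<close>

section \<open>Half the order separates packings from 1-limited dominating sets\<close>

lemma (in pair_graph) finite_open_nbhd: "finite (open_nbhd G v)"
  by (rule finite_subset[OF _ pair_finite_verts])
    (auto simp: open_nbhd_def dest: in_arcsD2)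

lemma (in pair_graph) closed_nbhd_subset: "v \<in> pverts G \<Longrightarrow> closed_nbhd G v \<subseteq> pverts G"
  by (auto simp: closed_nbhd_def open_nbhd_def dest: in_arcsD2)

lemma (in pair_graph) card_closed_nbhd: "card (closed_nbhd G v) = Suc (card (open_nbhd G v))"
proof -
  have "v \<notin> open_nbhd G v" using no_loops'[of v v] by (auto simp: open_nbhd_def)
  then show ?thesis by (simp add: closed_nbhd_def finite_open_nbhd)
qed

lemma (in pair_graph) card_closed_nbhd_ge_2:
  assumes "connected G" and "2 \<le> card (pverts G)" and "v \<in> pverts G"
  shows "2 \<le> card (closed_nbhd G v)"
proof -
  obtain w where w: "w \<in> pverts G" "w \<noteq> v"
    using assms(2,3) by (metis card_2_iff' obtain_subset_with_card_n subsetD)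
  have "(v, w) \<in> rtrancl_on (pverts G) ((parcs G)\<^sup>s)"
    using assms(1,3) w(1) by (simp add: connected_conv)
  then obtain x where "(v, x) \<in> (parcs G)\<^sup>s"
    using w(2) by (cases rule: converse_rtrancl_on_cases) auto
  then have "x \<in> open_nbhd G v"
    by (auto simp: open_nbhd_def symcl_def dest: arcs_symmetric)
  then have "card (open_nbhd G v) \<noteq> 0"
    using finite_open_nbhd by auto
  then show ?thesis by (simp add: card_closed_nbhd)
qed

lemma (in pair_graph) finite_packing: "packing G S \<Longrightarrow> finite S"
  using finite_subset[OF _ pair_finite_verts] by (auto simp: packing_def)

lemma (in pair_graph) card_UN_packing:
  assumes "packing G S"
  shows "card (\<Union>u\<in>S. closed_nbhd G u) = (\<Sum>u\<in>S. card (closed_nbhd G u))"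
proof (rule card_UN_disjoint)
  show "finite S" using assms by (rule finite_packing)
qed (use assms in \<open>auto simp: packing_def closed_nbhd_def finite_open_nbhd\<close>)

lemma (in pair_graph) sum_closed_nbhd_packing_le:
  assumes "packing G S"
  shows "(\<Sum>u\<in>S. card (closed_nbhd G u)) \<le> card (pverts G)"
  unfolding card_UN_packing[OF assms, symmetric]
  using assms closed_nbhd_subset
  by (intro card_mono pair_finite_verts) (auto simp: packing_def)

lemma (in pair_graph) card_packing_le:
  assumes "connected G" and "2 \<le> card (pverts G)" and "packing G S"
  shows "2 * card S \<le> card (pverts G)"
proof -
  have "2 * card S = (\<Sum>u\<in>S. 2)" by simp
  also have "\<dots> \<le> (\<Sum>u\<in>S. card (closed_nbhd G u))"
    using assms by (intro sum_mono card_closed_nbhd_ge_2) (auto simp: packing_def)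
  also have "\<dots> \<le> card (pverts G)" by (rule sum_closed_nbhd_packing_le) fact
  finally show ?thesis .
qed

text \<open>
  The sets \<open>open_nbhd G u - D\<close> for \<open>u \<in> D\<close> cover the complement of \<open>D\<close> by domination, and each of
  them has at most one element.
\<close>

lemma (in pair_graph) card_limited1_dominating_ge:
  assumes "limited1_dominating_set G D"
  shows "card (pverts G) \<le> 2 * card D"
proof -
  have D: "D \<subseteq> pverts G" "finite D"
    using assms finite_subset[OF _ pair_finite_verts]
    by (auto simp: limited1_dominating_set_def dominating_set_def)
  have "pverts G - D \<subseteq> (\<Union>u\<in>D. open_nbhd G u - D)"
    using assms arcs_symmetric
    by (fastforce simp: limited1_dominating_set_def dominating_set_def open_nbhd_def)
  then have "card (pverts G - D) \<le> card (\<Union>u\<in>D. open_nbhd G u - D)"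
    by (intro card_mono) (use D finite_open_nbhd in auto)
  also have "\<dots> \<le> (\<Sum>u\<in>D. card (open_nbhd G u - D))"
    by (rule card_UN_le) (rule D)
  also have "\<dots> \<le> (\<Sum>u\<in>D. 1)"
    using assms by (intro sum_mono) (auto simp: limited1_dominating_set_def)
  finally show ?thesis
    using D by (simp add: card_Diff_subset)
qed

lemma (in pair_graph) card_le_packing_number:
  assumes "packing G S"
  shows "card S \<le> packing_number G"
proof -
  have "{card S | S. packing G S} \<subseteq> card ` Pow (pverts G)"
    by (auto simp: packing_def)
  then have "finite {card S | S. packing G S}"
    using pair_finite_verts finite_subset by blast
  then show ?thesis
    unfolding packing_number_def using assms by (intro Max_ge) auto
qed

lemma (in pair_graph) limited1_domination_number_le_card:
  assumes "limited1_dominating_set G D"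
  shows "limited1_domination_number G \<le> card D"
proof -
  have "{card D | D. limited1_dominating_set G D} \<subseteq> card ` Pow (pverts G)"
    by (auto simp: limited1_dominating_set_def dominating_set_def)
  then have "finite {card D | D. limited1_dominating_set G D}"
    using pair_finite_verts finite_subset by blast
  then show ?thesis
    unfolding limited1_domination_number_def using assms by (intro Min_le) auto
qed

section \<open>The leaves of a corona\<close>

text \<open>
  An isomorphism of general digraphs carries separate maps for vertices, arcs, heads and tails.
  When arcs are pairs of vertices, the vertex map determines the others.
\<close>

lemma digraph_iso_with_proj_iff:
  assumes "pair_wf_digraph A"
  shows "digraph_iso (with_proj A) (with_proj B) \<longleftrightarrow>
    (\<exists>h. inj_on h (pverts A) \<and> pverts B = h ` pverts A \<and> parcs B = map_prod h h ` parcs A)"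
    (is "?iso \<longleftrightarrow> ?bij")
proof
  interpret A: pair_wf_digraph A by fact
  assume ?iso
  then obtain f where f: "A.digraph_isomorphism f" and B: "with_proj B = app_iso f (with_proj A)"
    by (auto simp: digraph_iso_def)
  let ?h = "iso_verts f"
  from B have "pverts B = ?h ` pverts A" and parcs: "parcs B = iso_arcs f ` parcs A"
    and ends: "iso_tail f = fst" "iso_head f = snd"
    by (auto simp: with_proj_def app_iso_def)
  moreover have "iso_arcs f a = map_prod ?h ?h a" if "a \<in> parcs A" for a
    using A.iso_verts_tail[OF f that] A.iso_verts_head[OF f that]
    by (simp add: ends prod_eq_iff)
  then have "iso_arcs f ` parcs A = map_prod ?h ?h ` parcs A"
    by (rule image_cong[OF refl])
  moreover have "inj_on ?h (pverts A)"
    using A.digraph_isomorphism_inj_on_verts[OF f] .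
  ultimately show ?bij by auto
next
  interpret A: pair_wf_digraph A by fact
  assume ?bij
  then obtain h where h: "inj_on h (pverts A)" "pverts B = h ` pverts A"
    "parcs B = map_prod h h ` parcs A" by blast
  let ?f = "\<lparr>iso_verts = h, iso_arcs = map_prod h h, iso_head = snd, iso_tail = fst\<rparr>"
  have "parcs A \<subseteq> pverts A \<times> pverts A"
    using A.in_arcsD1 A.in_arcsD2 by auto
  then have "inj_on (map_prod h h) (parcs A)"
    by (rule inj_on_subset[OF map_prod_inj_on[OF h(1) h(1)]])
  then have "A.digraph_isomorphism ?f"
    using h(1) A.wf_digraph_axioms by (simp add: A.digraph_isomorphism_def)
  moreover have "with_proj B = app_iso ?f (with_proj A)"
    using h by (simp add: with_proj_def app_iso_def)
  ultimately show ?iso unfolding digraph_iso_def by blast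
qed

text \<open>
  The set is that of the pendant vertices. Each has its stem as its only neighbor; different leaves
  have different stems, and every other vertex is the stem of a leaf.
\<close>

lemma corona_graph_packing_dominating:
  assumes "pair_graph G" and "corona_graph G"
  shows "\<exists>S. packing G S \<and> limited1_dominating_set G S"
proof -
  interpret G: pair_graph G by fact
  obtain H :: "'a pair_pre_digraph" where H: "pair_graph H"
    and iso: "digraph_iso (with_proj (corona_K1 H)) (with_proj G)"
    using assms(2) by (auto simp: corona_graph_def)
  interpret H: pair_graph H by fact
  interpret C: pair_graph "corona_K1 H" by (rule pair_graph_corona_K1) fact
  obtain h where h: "inj_on h (pverts (corona_K1 H))" "pverts G = h ` pverts (corona_K1 H)"
    "parcs G = map_prod h h ` parcs (corona_K1 H)"
    using iso unfolding digraph_iso_with_proj_iff[OF C.pair_wf_digraph] by blast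
  let ?S = "(\<lambda>v. h (Inr v)) ` pverts H"
  have eq: "h x = h y \<longleftrightarrow> x = y" if "x \<in> pverts (corona_K1 H)" "y \<in> pverts (corona_K1 H)" for x y
    using inj_on_eq_iff[OF h(1) that] .
  have arc: "(h x, h y) \<in> parcs G \<longleftrightarrow> (x, y) \<in> parcs (corona_K1 H)"
    if "x \<in> pverts (corona_K1 H)" "y \<in> pverts (corona_K1 H)" for x y
  proof
    assume "(h x, h y) \<in> parcs G"
    then obtain a b where ab: "(a, b) \<in> parcs (corona_K1 H)" "h x = h a" "h y = h b"
      unfolding h(3) by auto
    then have "x = a" "y = b"
      using that eq C.in_arcsD1[OF ab(1)] C.in_arcsD2[OF ab(1)] by blast+
    then show "(x, y) \<in> parcs (corona_K1 H)" using ab(1) by simp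
  qed (simp add: h(3) map_prod_imageI)
  have nbhd: "open_nbhd G (h (Inr v)) = {h (Inl v)}" if "v \<in> pverts H" for v
  proof -
    have Inr: "Inr v \<in> pverts (corona_K1 H)" using that by (simp add: corona_K1_def)
    have pendant: "(Inr v, y) \<in> parcs (corona_K1 H) \<longleftrightarrow> y = Inl v" for y
      using that by (auto simp: corona_K1_def)
    have "x \<in> open_nbhd G (h (Inr v)) \<longleftrightarrow> x = h (Inl v)" for x
      using arc[OF Inr] pendant C.in_arcsD2[of "Inr v" "Inl v"] G.in_arcsD2[of "h (Inr v)" x]
      unfolding open_nbhd_def h(2) by auto
    then show ?thesis by blast
  qed
  have verts: "Inl v \<in> pverts (corona_K1 H)" "Inr v \<in> pverts (corona_K1 H)" if "v \<in> pverts H" for v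
    using that by (auto simp: corona_K1_def)
  have sub: "?S \<subseteq> pverts G" using h(2) verts by auto
  have "packing G ?S"
    using sub eq verts by (auto simp: packing_def closed_nbhd_def nbhd)
  moreover have "\<exists>u\<in>?S. u \<in> open_nbhd G w" if w: "w \<in> pverts G - ?S" for w
  proof -
    obtain v where "v \<in> pverts H" "w = h (Inl v)"
      using w h(2) by (auto simp: corona_K1_def)
    then have "h (Inr v) \<in> open_nbhd G w"
      using nbhd[of v] G.arcs_symmetric by (auto simp: open_nbhd_def)
    then show ?thesis using \<open>v \<in> pverts H\<close> by blast
  qed
  moreover have "card (open_nbhd G u - ?S) \<le> 1" if "u \<in> ?S" for u
    using that by (auto simp: nbhd intro: card_Diff1_le order_trans[OF card_mono[of "{_}"]])
  ultimately show ?thesis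
    using sub unfolding limited1_dominating_set_def dominating_set_def by blast
qed

section \<open>Graphs with a packing of half the order\<close>

text \<open>
  This is the equality case of \<open>card_packing_le\<close>: a sum of terms that are at least two is at most
  twice the number of terms, so that all terms are equal to two and the union fills the vertex set.
\<close>

lemma (in pair_graph) half_packing_partition:
  assumes "connected G" and "2 \<le> card (pverts G)"
    and S: "packing G S" and half: "2 * card S = card (pverts G)"
  shows "\<And>u. u \<in> S \<Longrightarrow> card (closed_nbhd G u) = 2"
    and "(\<Union>u\<in>S. closed_nbhd G u) = pverts G"
proof -
  have fin: "finite S" using S by (rule finite_packing)
  have ge: "2 \<le> card (closed_nbhd G u)" if "u \<in> S" for u
    using that assms(1,2) S card_closed_nbhd_ge_2 by (auto simp: packing_def)
  have "(\<Sum>u\<in>S. 2) \<le> (\<Sum>u\<in>S. card (closed_nbhd G u))"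
    by (rule sum_mono) (rule ge)
  then have sum: "(\<Sum>u\<in>S. 2) = (\<Sum>u\<in>S. card (closed_nbhd G u))"
    using sum_closed_nbhd_packing_le[OF S] half by simp
  show "card (closed_nbhd G u) = 2" if "u \<in> S" for u
    using sum_mono_inv[OF sum ge that fin] by simp
  show "(\<Union>u\<in>S. closed_nbhd G u) = pverts G"
  proof (rule card_subset_eq[OF pair_finite_verts])
    show "(\<Union>u\<in>S. closed_nbhd G u) \<subseteq> pverts G"
      using S closed_nbhd_subset by (auto simp: packing_def)
    show "card (\<Union>u\<in>S. closed_nbhd G u) = card (pverts G)"
      using sum half by (simp add: card_UN_packing[OF S])
  qed
qed

text \<open>
  The map may contract edges, so that it need not be a homomorphism of simple graphs; this is what
  allows for the retraction that moves leaves to their neighbors.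
\<close>

lemma connected_image:
  assumes "connected (with_proj G)"
    and onto: "r ` pverts G = pverts H"
    and arcs: "\<And>u v. (u, v) \<in> parcs G \<Longrightarrow> r u = r v \<or> (r u, r v) \<in> parcs H"
  shows "connected (with_proj H)"
proof -
  have "(r u, r v) \<in> rtrancl_on (pverts H) ((parcs H)\<^sup>s)"
    if "(u, v) \<in> rtrancl_on (pverts G) ((parcs G)\<^sup>s)" for u v
    using that
  proof (induction rule: rtrancl_on.induct)
    case (rtrancl_on_refl a)
    then show ?case using onto by auto
  next
    case (rtrancl_on_into_rtrancl_on a b c)
    have "r b = r c \<or> (r b, r c) \<in> (parcs H)\<^sup>s"
      using rtrancl_on_into_rtrancl_on.hyps arcs[of b c] arcs[of c b]
      by (auto simp: symcl_def)
    moreover have "r c \<in> pverts H"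
      using rtrancl_on_into_rtrancl_on.hyps onto by auto
    ultimately show ?case
      using rtrancl_on_into_rtrancl_on.IH
      by (auto intro: rtrancl_on.rtrancl_on_into_rtrancl_on)
  qed
  moreover have "pverts G \<noteq> {}"
    and "\<And>u v. u \<in> pverts G \<Longrightarrow> v \<in> pverts G \<Longrightarrow> (u, v) \<in> rtrancl_on (pverts G) ((parcs G)\<^sup>s)"
    using assms(1) by (simp_all add: connected_conv)
  ultimately show ?thesis
    unfolding connected_conv with_proj_simps onto[symmetric] by blast
qed

lemma (in pair_graph) half_packing_imp_corona_graph:
  assumes "connected G" and "2 \<le> card (pverts G)"
    and S: "packing G S" and half: "2 * card S = card (pverts G)"
  shows "corona_graph G"
proof -
  note part = half_packing_partition[OF assms]
  have "\<exists>x. open_nbhd G u = {x}" if "u \<in> S" for u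
    using part(1)[OF that] by (simp add: card_closed_nbhd card_1_singleton_iff)
  then obtain s where s: "\<And>u. u \<in> S \<Longrightarrow> open_nbhd G u = {s u}" by metis
  have s_iff: "(u, x) \<in> parcs G \<longleftrightarrow> x = s u" if "u \<in> S" for u x
    using s[OF that] by (auto simp: open_nbhd_def)
  have disj: "closed_nbhd G u \<inter> closed_nbhd G v = {}" if "u \<in> S" "v \<in> S" "u \<noteq> v" for u v
    using S that by (simp add: packing_def)
  have s_notin: "s u \<notin> S" if "u \<in> S" for u
    using disj[of u "s u"] that s[OF that] s_iff[OF that] no_loops'[of u u]
    by (auto simp: closed_nbhd_def)
  have inj: "inj_on s S"
    using disj s by (fastforce simp: inj_on_def closed_nbhd_def)
  have V: "pverts G = s ` S \<union> S"
    unfolding part(2)[symmetric] using s by (auto simp: closed_nbhd_def)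
  \<comment> \<open>By \<open>s_notin\<close> and \<open>V\<close> this is the subgraph induced by the complement of \<open>S\<close>.\<close>
  define H where "H = \<lparr>pverts = s ` S, parcs = parcs G \<inter> (s ` S \<times> s ` S)\<rparr>"
  have H: "pair_graph H"
  proof
    show "finite (pverts H)" "finite (parcs H)"
      using V pair_finite_verts pair_finite_arcs by (auto simp: H_def)
    show "symmetric H"
      using arcs_symmetric by (auto simp: H_def symmetric_def intro: symI)
  qed (use no_loops' in \<open>auto simp: H_def\<close>)
  interpret H: pair_graph H by (rule H)
  interpret C: pair_graph "corona_K1 H" by (rule pair_graph_corona_K1) (rule H)
  have "connected H"
  proof (rule connected_image[OF assms(1)])
    let ?r = "\<lambda>x. if x \<in> S then s x else x"
    show "?r ` pverts G = pverts H"
      using s_notin by (auto simp: V H_def)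
    show "?r u = ?r v \<or> (?r u, ?r v) \<in> parcs H" if "(u, v) \<in> parcs G" for u v
    proof -
      consider "u \<in> S" | "v \<in> S" | "u \<notin> S" "v \<notin> S" by blast
      then show ?thesis
      proof cases
        case 1
        then show ?thesis using that s_iff s_notin by simp
      next
        case 2
        then show ?thesis using arcs_symmetric[OF that] s_iff s_notin by simp
      next
        case 3
        then show ?thesis
          using that in_arcsD1[OF that] in_arcsD2[OF that] by (simp add: V H_def)
      qed
    qed
  qed
  moreover have "digraph_iso (corona_K1 H) G"
  proof -
    let ?l = "inv_into S s"
    \<comment> \<open>The copy of a stem in \<open>H\<close> goes to that stem, its pendant vertex to the leaf at it.\<close>
    define h where "h = case_sum (\<lambda>v. v) ?l"
    have l: "?l (s u) = u" if "u \<in> S" for u using inj that by (rule inv_into_f_f)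
    have "inj_on h (pverts (corona_K1 H))"
      using s_notin l by (auto simp: inj_on_def corona_K1_def H_def h_def)
    moreover have "pverts G = h ` pverts (corona_K1 H)"
      using l by (auto simp: V corona_K1_def H_def h_def image_Un image_image)
    moreover have "parcs G = map_prod h h ` parcs (corona_K1 H)"
    proof -
      have "parcs (corona_K1 H) = map_prod Inl Inl ` parcs H
          \<union> (\<lambda>u. (Inl (s u), Inr (s u))) ` S \<union> (\<lambda>u. (Inr (s u), Inl (s u))) ` S"
        by (auto simp: corona_K1_def H_def)
      then have "map_prod h h ` parcs (corona_K1 H) =
          parcs H \<union> (\<lambda>u. (s u, u)) ` S \<union> (\<lambda>u. (u, s u)) ` S"
        using l by (simp add: h_def image_Un image_image map_prod.compositionality comp_def
            map_prod.identity[unfolded id_def])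
      also have "\<dots> = parcs G"
      proof (intro equalityI subrelI)
        fix u v assume "(u, v) \<in> parcs H \<union> (\<lambda>u. (s u, u)) ` S \<union> (\<lambda>u. (u, s u)) ` S"
        then show "(u, v) \<in> parcs G"
          using s_iff arcs_symmetric by (auto simp: H_def)
      next
        fix u v assume uv: "(u, v) \<in> parcs G"
        have "u = s v" if "v \<in> S" using arcs_symmetric[OF uv] s_iff[OF that] by simp
        moreover have "v = s u" if "u \<in> S" using uv s_iff[OF that] by simp
        moreover have "(u, v) \<in> parcs H" if "u \<notin> S" "v \<notin> S"
          using that uv in_arcsD1[OF uv] in_arcsD2[OF uv] by (simp add: V H_def)
        ultimately show "(u, v) \<in> parcs H \<union> (\<lambda>u. (s u, u)) ` S \<union> (\<lambda>u. (u, s u)) ` S"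
          by blast
      qed
      finally show ?thesis ..
    qed
    ultimately show ?thesis
      unfolding digraph_iso_with_proj_iff[OF C.pair_wf_digraph] by blast
  qed
  ultimately show ?thesis
    unfolding corona_graph_def using H by blast
qed

section \<open>Equality of the two parameters characterizes coronas\<close>

theorem corollary15:
  fixes G :: "'a pair_pre_digraph" and n :: nat
  assumes "pair_graph G"
    and "connected G"
    and "card (pverts G) = n"
    and "even n"
    and "n \<ge> 4"
  shows "(packing_number G = n div 2 \<longleftrightarrow> limited1_domination_number G = packing_number G)
       \<and> (limited1_domination_number G = packing_number G \<longleftrightarrow> corona_graph G)"
proof -
  interpret pair_graph G by fact
  have n2: "2 \<le> card (pverts G)" using assms(3,5) by simp
  obtain S where S: "packing G S" "card S = packing_number G"
    using packing_number_attained[OF assms(1)] by blast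
  obtain D where D: "limited1_dominating_set G D" "card D = limited1_domination_number G"
    using limited1_domination_number_attained[OF assms(1)] by blast
  have upper: "2 * packing_number G \<le> n"
    using card_packing_le[OF assms(2) n2 S(1)] S(2) assms(3) by simp
  have lower: "n \<le> 2 * limited1_domination_number G"
    using card_limited1_dominating_ge[OF D(1)] D(2) assms(3) by simp
  have "packing_number G = n div 2" if "limited1_domination_number G = packing_number G"
    using that upper lower by simp
  moreover have "corona_graph G" if "packing_number G = n div 2"
    using half_packing_imp_corona_graph[OF assms(2) n2 S(1)] S(2) that assms(3,4) by simp
  moreover have "limited1_domination_number G = packing_number G" if corona: "corona_graph G"
  proof -
    obtain L where "packing G L" "limited1_dominating_set G L"
      using corona_graph_packing_dominating[OF assms(1) corona] by blast
    then have "limited1_domination_number G \<le> packing_number G"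
      using card_le_packing_number limited1_domination_number_le_card order_trans by blast
    then show ?thesis using upper lower by simp
  qed
  ultimately show ?thesis by blast
qed

end
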